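(* Let $d,\theta\ge 3$ be fixed integers and let $p=f(n)\,n^{-1-d/\theta}$. If $f(n)\to 0$ as $n\to\infty$, then $$\mathbb{P}_p\Bigl(\exists v\in V:\ \sum_{w\sim v}\omega_0(w)\ge\theta\Bigr)\to 0,$$ and if $f(n)\to\infty$ as $n\to\infty$, then $$\mathbb{P}_p\bigl(\exists\text{ a line }\ell\text{ such that }\omega_\infty|_\ell\equiv 1\bigr)\to 1.$$
   Context: Hamming torus: $V=[n]^d$ with $[n]=\{1,\dots,n\}$; two vertices $v,w$ are adjacent ($v\sim w$) iff $v-w$ has exactly one nonzero coordinate. Bootstrap percolation with threshold $\theta$: starting from $\omega_0\in\{0,1\}^V$, set $\omega_{j+1}(v)=1$ if $\omega_j(v)=1$ or $\sum_{w\sim v}\omega_j(w)\ge\theta$, and $\omega_{j+1}(v)=0$ otherwise; $\omega_\infty$ is the pointwise limit of the increasing sequence $\omega_j$. Under $\mathbb{P}_p$ the values $\omega_0(v)$, $v\in V$, are i.i.d. Bernoulli($p$), $p=p(n)\in[0,1]$. A line is a set of $n$ vertices obtained by fixing $d-1$ coordinates and letting the remaining one range over $[n]$. *)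

theory Defs
  imports "HOL-Probability.Probability" "HOL-Probability.Product_PMF"
begin

text \<open>Coordinates of a vertex are indexed by \<open>{1..d}\<close>; vertices are extensional functions, so that
  equality of vertices is equality of all \<open>d\<close> coordinates.\<close>

definition hamming_verts :: "nat \<Rightarrow> nat \<Rightarrow> (nat \<Rightarrow> nat) set" where
  "hamming_verts n d = PiE {1..d} (\<lambda>_. {1..n})"

definition hamming_adj :: "nat \<Rightarrow> nat \<Rightarrow> (nat \<Rightarrow> nat) \<Rightarrow> (nat \<Rightarrow> nat) \<Rightarrow> bool" where
  "hamming_adj n d v w \<longleftrightarrow>
     v \<in> hamming_verts n d \<and> w \<in> hamming_verts n d \<and> card {i \<in> {1..d}. v i \<noteq> w i} = 1"

definition hamming_line :: "nat \<Rightarrow> nat \<Rightarrow> (nat \<Rightarrow> nat) set \<Rightarrow> bool" where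
  "hamming_line n d l \<longleftrightarrow>
     (\<exists>i \<in> {1..d}. \<exists>u \<in> hamming_verts n d.
        l = {v \<in> hamming_verts n d. \<forall>j \<in> {1..d} - {i}. v j = u j})"

text \<open>Configurations take the values 0 and 1 in \<^typ>\<open>nat\<close>.\<close>

type_synonym config = "(nat \<Rightarrow> nat) \<Rightarrow> nat"

definition nbr_sum :: "nat \<Rightarrow> nat \<Rightarrow> config \<Rightarrow> (nat \<Rightarrow> nat) \<Rightarrow> nat" where
  "nbr_sum n d \<omega> v = (\<Sum>w | hamming_adj n d v w. \<omega> w)"

definition bp_step :: "nat \<Rightarrow> nat \<Rightarrow> nat \<Rightarrow> config \<Rightarrow> config" where
  "bp_step n d \<theta> \<omega> = (\<lambda>v. if \<omega> v = 1 \<or> \<theta> \<le> nbr_sum n d \<omega> v then 1 else 0)"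

definition bp_iter :: "nat \<Rightarrow> nat \<Rightarrow> nat \<Rightarrow> config \<Rightarrow> nat \<Rightarrow> config" where
  "bp_iter n d \<theta> \<omega> j = (bp_step n d \<theta> ^^ j) \<omega>"

definition bp_final :: "nat \<Rightarrow> nat \<Rightarrow> nat \<Rightarrow> config \<Rightarrow> config" where
  "bp_final n d \<theta> \<omega> = (\<lambda>v. lim (\<lambda>j. bp_iter n d \<theta> \<omega> j v))"

text \<open>The i.i.d. Bernoulli field; off the vertex set the configuration is constantly 0.\<close>

definition init_pmf :: "nat \<Rightarrow> nat \<Rightarrow> real \<Rightarrow> config pmf" where
  "init_pmf n d p = Pi_pmf (hamming_verts n d) 0 (\<lambda>_. map_pmf of_bool (bernoulli_pmf p))"

lemma bp_iter_le_1:
  assumes "\<And>v. \<omega> v \<le> 1"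
  shows "bp_iter n d \<theta> \<omega> j v \<le> 1"
  using assms by (cases j) (auto simp: bp_iter_def bp_step_def)

lemma incseq_bp_iter:
  assumes "\<And>v. \<omega> v \<le> 1"
  shows "incseq (\<lambda>j. bp_iter n d \<theta> \<omega> j v)"
proof (rule incseq_SucI)
  fix j
  have "bp_iter n d \<theta> \<omega> j v \<le> 1"
    by (rule bp_iter_le_1) (rule assms)
  then show "bp_iter n d \<theta> \<omega> j v \<le> bp_iter n d \<theta> \<omega> (Suc j) v"
    by (auto simp: bp_iter_def bp_step_def)
qed

lemma bp_final_LIMSEQ:
  assumes "\<And>v. \<omega> v \<le> 1"
  shows "(\<lambda>j. bp_iter n d \<theta> \<omega> j v) \<longlonglongrightarrow> bp_final n d \<theta> \<omega> v"
proof -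
  let ?X = "\<lambda>j. bp_iter n d \<theta> \<omega> j v"
  have le: "?X j \<le> 1" for j
    by (rule bp_iter_le_1) (rule assms)
  have inc: "incseq ?X"
    by (rule incseq_bp_iter) (rule assms)
  have "\<exists>L. ?X \<longlonglongrightarrow> L"
  proof (cases "\<exists>j. ?X j = 1")
    case True
    then obtain j where j: "?X j = 1" by blast
    have "?X k = 1" if "k \<ge> j" for k
      using incseqD[OF inc that] le[of k] j by linarith
    then have "?X \<longlonglongrightarrow> 1"
      by (intro tendsto_eventually) (auto simp: eventually_sequentially)
    then show ?thesis by blast
  next
    case False
    then have "?X j = 0" for j
      using le[of j] by (metis le_neq_implies_less less_one)
    then have "?X \<longlonglongrightarrow> 0" by simp
    then show ?thesis by blast
  qed
  then have "convergent ?X" by (auto simp: convergent_def)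
  then show ?thesis unfolding bp_final_def by (simp add: convergent_LIMSEQ_iff)
qed

end

theory Submission
  imports Defs "HOL-Real_Asymp.Real_Asymp"
begin

text \<open>A line has on average \<open>n p = f / n powr (d / \<theta>)\<close> open points. A vertex has at most \<open>d n\<close>
  neighbours, so the expected number of vertices with \<open>\<theta>\<close> open neighbours is at most
  \<open>n ^ d * (d n p) ^ \<theta> = (d f) ^ \<theta>\<close>, which vanishes with \<open>f\<close>. This is the subcritical half
  (\<open>prob_threshold_le\<close>).

  When \<open>f\<close> tends to infinity there are many vertices with \<open>\<theta>\<close> open neighbours, and the point is that
  one of them starts a chain reaction. Let \<open>k\<close> be the integer part of \<open>(d - 1) \<theta> / d\<close>, and look for a
  line with \<open>k\<close> open points and, on it, a vertex that has \<open>\<theta> - k\<close> open neighbours off the line. The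
  expected number of such pairs is of order \<open>f ^ \<theta>\<close>. Once that vertex has opened, the line has
  \<open>k + 1\<close> open points, and its other vertices need only \<open>\<theta> - k - 1\<close> open neighbours off the line. A line
  contains about \<open>n (n p) ^ (\<theta> - k - 1)\<close> vertices of that kind, and by the choice of \<open>k\<close> this number
  tends to infinity; so soon \<open>\<theta>\<close> points of the line are open, and then the whole line fills
  (\<open>good_plane_fills_line\<close>).

  A second moment computation is avoided by building the event from independent pieces. Lines are taken
  in direction 1 and off-line neighbours in direction 2, so that everything happens in one of the
  \<open>n ^ (d - 2)\<close> disjoint planes obtained by fixing the coordinates \<open>3, \<dots>, d\<close>. Inside a plane the
  coordinate range contains \<open>2 \<theta> + 1\<close> disjoint blocks of size \<open>m\<close> proportional to \<open>n\<close>, and each ingredient of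
  the construction is sought in blocks of its own. Every ingredient is then a nested
  ``exists, for all, exists'' over disjoint sets of vertices, and the elementary bound
  \<open>1 - exp (- x) \<ge> min 1 x / 2\<close> shows that it has probability at least a constant times the minimum
  of 1 and its expected count (\<open>prob_fibre_hits_ge\<close>, \<open>prob_good_plane_ge\<close>).
  It remains to see that \<open>n ^ (d - 2)\<close> times the product of these minima diverges, which is
  \<open>plane_count_growth\<close>.\<close>

section \<open>Independence of events on disjoint coordinate sets\<close>

definition depends_on :: "'a set \<Rightarrow> (('a \<Rightarrow> 'b) \<Rightarrow> bool) \<Rightarrow> bool" where
  "depends_on A E \<longleftrightarrow> (\<forall>\<omega> \<omega>'. (\<forall>v\<in>A. \<omega> v = \<omega>' v) \<longrightarrow> E \<omega> = E \<omega>')"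

lemma depends_onD: "depends_on A E \<Longrightarrow> (\<And>v. v \<in> A \<Longrightarrow> \<omega> v = \<omega>' v) \<Longrightarrow> E \<omega> = E \<omega>'"
  unfolding depends_on_def by blast

lemma depends_on_mono: "depends_on A E \<Longrightarrow> A \<subseteq> B \<Longrightarrow> depends_on B E"
  unfolding depends_on_def by blast

lemma depends_on_value: "depends_on {v} (\<lambda>\<omega>. \<omega> v = c)"
  unfolding depends_on_def by simp

lemma depends_on_Not: "depends_on A E \<Longrightarrow> depends_on A (\<lambda>\<omega>. \<not> E \<omega>)"
  unfolding depends_on_def by blast

lemma depends_on_conj: "depends_on A E \<Longrightarrow> depends_on A F \<Longrightarrow> depends_on A (\<lambda>\<omega>. E \<omega> \<and> F \<omega>)"
  unfolding depends_on_def by blast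

lemma depends_on_Ball:
  "(\<And>i. i \<in> I \<Longrightarrow> depends_on A (E i)) \<Longrightarrow> depends_on A (\<lambda>\<omega>. \<forall>i\<in>I. E i \<omega>)"
  unfolding depends_on_def by blast

lemma depends_on_Bex:
  "(\<And>i. i \<in> I \<Longrightarrow> depends_on A (E i)) \<Longrightarrow> depends_on A (\<lambda>\<omega>. \<exists>i\<in>I. E i \<omega>)"
  unfolding depends_on_def by blast

lemma prob_mono_on_support:
  assumes "\<And>\<omega>. \<omega> \<in> set_pmf M \<Longrightarrow> \<omega> \<in> X \<Longrightarrow> \<omega> \<in> Y"
  shows "measure_pmf.prob M X \<le> measure_pmf.prob M Y"
  using assms by (intro measure_pmf.finite_measure_mono_AE) (auto simp: AE_measure_pmf_iff)

text \<open>Only the traces of the two events on the countable supports matter, so the product formula for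
  countable events extends to arbitrary ones.\<close>

lemma prob_pair_pmf_Times:
  "measure_pmf.prob (pair_pmf M N) (A \<times> B) = measure_pmf.prob M A * measure_pmf.prob N B"
proof -
  have "measure_pmf.prob (pair_pmf M N) (A \<times> B)
      = measure_pmf.prob (pair_pmf M N) ((A \<times> B) \<inter> set_pmf (pair_pmf M N))"
    by (rule measure_Int_set_pmf[symmetric])
  also have "(A \<times> B) \<inter> set_pmf (pair_pmf M N) = (A \<inter> set_pmf M) \<times> (B \<inter> set_pmf N)"
    by auto
  also have "measure_pmf.prob (pair_pmf M N) \<dots>
      = measure_pmf.prob M (A \<inter> set_pmf M) * measure_pmf.prob N (B \<inter> set_pmf N)"
    by (rule measure_pmf_prob_product) (auto intro: countable_subset[OF _ countable_set_pmf])
  finally show ?thesis by (simp add: measure_Int_set_pmf)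
qed

text \<open>The field on \<open>V\<close> is obtained by gluing independent fields on \<open>V \<inter> A\<close> and \<open>V - A\<close>. Each of the two
  events sees only one of them: outside its own part, a partial field has the default value that the
  glued field also takes off \<open>V\<close>. This is why \<open>A\<close> and \<open>B\<close> may contain points outside \<open>V\<close>.\<close>

lemma prob_conj_indep:
  fixes z :: 'b and D :: "'a \<Rightarrow> 'b pmf"
  assumes fin: "finite V" and E: "depends_on A E" and F: "depends_on B F" and AB: "A \<inter> B = {}"
  defines "M \<equiv> Pi_pmf V z D"
  shows "measure_pmf.prob M {\<omega>. E \<omega> \<and> F \<omega>} = measure_pmf.prob M {\<omega>. E \<omega>} * measure_pmf.prob M {\<omega>. F \<omega>}"
proof -
  define P where "P = Pi_pmf (V \<inter> A) z D"
  define Q where "Q = Pi_pmf (V - A) z D"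
  let ?h = "\<lambda>(f, g) x. if x \<in> V \<inter> A then f x else g x"
  have M: "M = map_pmf ?h (pair_pmf P Q)"
    using Pi_pmf_union[of "V \<inter> A" "V - A" z D] fin
    by (simp add: M_def P_def Q_def Int_Diff_disjoint Un_commute[of "V \<inter> A"] Un_Diff_Int)
  \<comment> \<open>Taking one of the two events to be trivially true also identifies the marginal probabilities
    under \<open>M\<close> with those under \<open>P\<close> and \<open>Q\<close>.\<close>
  have split: "measure_pmf.prob M {\<omega>. E' \<omega> \<and> F' \<omega>}
      = measure_pmf.prob P {\<omega>. E' \<omega>} * measure_pmf.prob Q {\<omega>. F' \<omega>}"
    if E': "depends_on A E'" and F': "depends_on B F'" for E' F'
  proof -
    have "E' (?h (f, g)) = E' f \<and> F' (?h (f, g)) = F' g" if "(f, g) \<in> set_pmf (pair_pmf P Q)" for f g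
    proof -
      have f: "f x = z" if "x \<notin> V \<inter> A" for x
        using set_Pi_pmf_subset[of "V \<inter> A" z D] fin that \<open>(f, g) \<in> _\<close> by (auto simp: P_def)
      have g: "g x = z" if "x \<notin> V - A" for x
        using set_Pi_pmf_subset[of "V - A" z D] fin that \<open>(f, g) \<in> _\<close> by (auto simp: Q_def)
      show ?thesis
        using f g AB by (auto intro!: depends_onD[OF E'] depends_onD[OF F'])
    qed
    then have "measure_pmf.prob (pair_pmf P Q) (?h -` {\<omega>. E' \<omega> \<and> F' \<omega>})
        = measure_pmf.prob (pair_pmf P Q) ({\<omega>. E' \<omega>} \<times> {\<omega>. F' \<omega>})"
      by (intro measure_pmf.finite_measure_eq_AE) (auto simp: AE_measure_pmf_iff)
    then show ?thesis by (simp add: M prob_pair_pmf_Times)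
  qed
  have T: "depends_on A (\<lambda>\<omega>. True)" "depends_on B (\<lambda>\<omega>. True)" for A B :: "'a set"
    by (simp_all add: depends_on_def)
  show ?thesis
    using split[OF E F] split[OF E T(2)] split[OF T(1) F] by simp
qed

lemma prob_Ball_indep:
  fixes z :: 'b and D :: "'a \<Rightarrow> 'b pmf"
  assumes fin: "finite V" and I: "finite I" and dep: "\<And>i. i \<in> I \<Longrightarrow> depends_on (A i) (E i)"
    and disj: "disjoint_family_on A I"
  defines "M \<equiv> Pi_pmf V z D"
  shows "measure_pmf.prob M {\<omega>. \<forall>i\<in>I. E i \<omega>} = (\<Prod>i\<in>I. measure_pmf.prob M {\<omega>. E i \<omega>})"
  using I dep disj
proof (induction I rule: finite_induct)
  case empty
  then show ?case by simp
next
  case (insert j I)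
  have d: "depends_on (\<Union>i\<in>I. A i) (\<lambda>\<omega>. \<forall>i\<in>I. E i \<omega>)"
    using insert.prems(1) by (intro depends_on_Ball) (rule depends_on_mono, auto)
  have "A j \<inter> (\<Union>i\<in>I. A i) = {}"
    using insert.prems(2) insert.hyps(2) by (auto simp: disjoint_family_on_def)
  from prob_conj_indep[OF fin insert.prems(1)[of j] d this, of z D]
  have "measure_pmf.prob M {\<omega>. E j \<omega> \<and> (\<forall>i\<in>I. E i \<omega>)}
      = measure_pmf.prob M {\<omega>. E j \<omega>} * measure_pmf.prob M {\<omega>. \<forall>i\<in>I. E i \<omega>}"
    by (simp add: M_def)
  moreover have "measure_pmf.prob M {\<omega>. \<forall>i\<in>I. E i \<omega>} = (\<Prod>i\<in>I. measure_pmf.prob M {\<omega>. E i \<omega>})"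
    using insert.prems by (intro insert.IH) (auto simp: disjoint_family_on_def)
  ultimately show ?case
    using insert.hyps by simp
qed

text \<open>No event occurs with probability \<open>\<Prod>i\<in>I. 1 - P (E i)\<close>, and \<open>1 - q \<le> exp (- q)\<close>. All lower bounds for
  the supercritical regime come from this inequality, applied to points, to lines and to planes.\<close>

lemma prob_Bex_indep_ge:
  fixes z :: 'b and D :: "'a \<Rightarrow> 'b pmf"
  assumes fin: "finite V" and I: "finite I" and dep: "\<And>i. i \<in> I \<Longrightarrow> depends_on (A i) (E i)"
    and disj: "disjoint_family_on A I"
  defines "M \<equiv> Pi_pmf V z D"
  assumes q: "\<And>i. i \<in> I \<Longrightarrow> q \<le> measure_pmf.prob M {\<omega>. E i \<omega>}"
  shows "1 - exp (- (real (card I) * q)) \<le> measure_pmf.prob M {\<omega>. \<exists>i\<in>I. E i \<omega>}"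
proof -
  have compl: "measure_pmf.prob M {\<omega>. \<not> G \<omega>} = 1 - measure_pmf.prob M {\<omega>. G \<omega>}" for G
    using measure_pmf.prob_compl[of "{\<omega>. G \<omega>}" M] by (simp add: Compl_eq_Diff_UNIV[symmetric] Collect_neg_eq)
  have "measure_pmf.prob M {\<omega>. \<forall>i\<in>I. \<not> E i \<omega>} = (\<Prod>i\<in>I. measure_pmf.prob M {\<omega>. \<not> E i \<omega>})"
    unfolding M_def using fin I disj by (intro prob_Ball_indep[where A = A] depends_on_Not dep)
  also have "\<dots> = (\<Prod>i\<in>I. 1 - measure_pmf.prob M {\<omega>. E i \<omega>})" by (simp add: compl)
  also have "\<dots> \<le> (\<Prod>i\<in>I. exp (- q))"
  proof (rule prod_mono, intro conjI)
    fix i assume "i \<in> I"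
    show "1 - measure_pmf.prob M {\<omega>. E i \<omega>} \<le> exp (- q)"
      using q[OF \<open>i \<in> I\<close>] exp_ge_add_one_self[of "- q"] by linarith
  qed simp
  also have "\<dots> = exp (- (real (card I) * q))"
    by (simp add: exp_of_nat_mult[symmetric])
  finally have "measure_pmf.prob M {\<omega>. \<not> (\<exists>i\<in>I. E i \<omega>)} \<le> exp (- (real (card I) * q))" by simp
  then show ?thesis unfolding compl by linarith
qed

text \<open>Since \<open>exp (- x) \<le> 1 / (1 + x)\<close>; this is the form in which an expected count \<open>x\<close> is turned into a
  probability.\<close>

lemma one_minus_exp_ge: "0 \<le> x \<Longrightarrow> min 1 x / 2 \<le> 1 - exp (- x)" for x :: real
proof -
  assume x: "0 \<le> x"
  have "exp (- x) \<le> 1 / (1 + x)"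
    using exp_ge_add_one_self[of x] x by (simp add: exp_minus field_simps)
  moreover have "1 / (1 + x) \<le> 1 - min 1 x / 2"
    using x by (cases "x \<le> 1") (auto simp: field_simps mult_left_le)
  ultimately show ?thesis by linarith
qed


section \<open>The Bernoulli field on the Hamming torus\<close>

lemma finite_hamming_verts [simp]: "finite (hamming_verts n d)"
  by (simp add: hamming_verts_def finite_PiE)

lemma set_init_pmf_le_1: "\<omega> \<in> set_pmf (init_pmf n d p) \<Longrightarrow> \<omega> v \<le> 1"
proof -
  assume "\<omega> \<in> set_pmf (init_pmf n d p)"
  then have \<omega>: "\<omega> \<in> PiE_dflt (hamming_verts n d) 0 (\<lambda>_. of_bool ` set_pmf (bernoulli_pmf p))"
    using set_Pi_pmf_subset'[of "hamming_verts n d" 0 "\<lambda>_. map_pmf of_bool (bernoulli_pmf p)"]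
    by (auto simp: init_pmf_def comp_def)
  show "\<omega> v \<le> 1"
  proof (cases "v \<in> hamming_verts n d")
    case True
    with \<omega> obtain b where "\<omega> v = of_bool b" by (auto simp: PiE_dflt_def)
    then show ?thesis by simp
  next
    case False
    with \<omega> show ?thesis by (simp add: PiE_dflt_def)
  qed
qed

lemma prob_open:
  assumes "v \<in> hamming_verts n d" "0 \<le> p" "p \<le> 1"
  shows "measure_pmf.prob (init_pmf n d p) {\<omega>. \<omega> v = 1} = p"
proof -
  have "measure_pmf.prob (init_pmf n d p) {\<omega>. \<omega> v = 1}
      = measure_pmf.prob (map_pmf (\<lambda>\<omega>. \<omega> v) (init_pmf n d p)) {1}"
    by (simp add: vimage_def)
  also have "\<dots> = measure_pmf.prob (map_pmf of_bool (bernoulli_pmf p)) {1::nat}"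
    using assms by (simp add: init_pmf_def Pi_pmf_component del: measure_map_pmf)
  also have "\<dots> = measure_pmf.prob (bernoulli_pmf p) {True}"
  proof -
    have "of_bool -` {1::nat} = {True}" by (auto simp: of_bool_def split: if_splits)
    then show ?thesis by simp
  qed
  finally show ?thesis using assms by (simp add: measure_pmf_single)
qed

lemma prob_all_open:
  assumes "S \<subseteq> hamming_verts n d" "0 \<le> p" "p \<le> 1"
  shows "measure_pmf.prob (init_pmf n d p) {\<omega>. \<forall>w\<in>S. \<omega> w = 1} = p ^ card S"
proof -
  have "finite S" using assms(1) by (rule finite_subset) simp
  then have "measure_pmf.prob (init_pmf n d p) {\<omega>. \<forall>w\<in>S. \<omega> w = 1}
      = (\<Prod>w\<in>S. measure_pmf.prob (init_pmf n d p) {\<omega>. \<omega> w = 1})"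
    unfolding init_pmf_def
    by (intro prob_Ball_indep[where A = "\<lambda>w. {w}"]) (auto intro: depends_on_value simp: disjoint_family_on_def simp del: One_nat_def)
  also have "\<dots> = (\<Prod>w\<in>S. p)"
    using assms by (intro prod.cong refl prob_open) auto
  finally show ?thesis by simp
qed


section \<open>The first moment bound\<close>

lemma card_hamming_verts: "card (hamming_verts n d) = n ^ d"
  by (simp add: hamming_verts_def card_PiE)

lemma hamming_nbrs_subset: "{w. hamming_adj n d v w} \<subseteq> hamming_verts n d"
  by (auto simp: hamming_adj_def)

lemma finite_hamming_nbrs [simp]: "finite {w. hamming_adj n d v w}"
  by (rule finite_subset[OF hamming_nbrs_subset]) simp

lemma card_hamming_nbrs_le: "card {w. hamming_adj n d v w} \<le> d * n"
proof -
  have "{w. hamming_adj n d v w} \<subseteq> (\<lambda>(i, a). v(i := a)) ` ({1..d} \<times> {1..n})"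
  proof
    fix w assume "w \<in> {w. hamming_adj n d v w}"
    then have vw: "v \<in> hamming_verts n d" "w \<in> hamming_verts n d"
      and "card {i \<in> {1..d}. v i \<noteq> w i} = 1" by (auto simp: hamming_adj_def)
    then obtain i where i: "{i \<in> {1..d}. v i \<noteq> w i} = {i}" by (auto simp: card_1_singleton_iff)
    have "w = v(i := w i)"
    proof
      fix j
      show "w j = (v(i := w i)) j"
      proof (cases "j \<in> {1..d}")
        case True
        then have "v j \<noteq> w j \<longleftrightarrow> j = i" using i by blast
        then show ?thesis by auto
      next
        case False
        then have "w j = undefined" "v j = undefined" "j \<noteq> i"
          using PiE_arb[OF vw(2)[unfolded hamming_verts_def] False]
            PiE_arb[OF vw(1)[unfolded hamming_verts_def] False] i False by blast+
        then show ?thesis by simp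
      qed
    qed
    moreover have "i \<in> {1..d}" using i by blast
    moreover from this have "w i \<in> {1..n}" using vw(2) unfolding hamming_verts_def by (rule PiE_mem[rotated])
    ultimately show "w \<in> (\<lambda>(i, a). v(i := a)) ` ({1..d} \<times> {1..n})"
      by (intro image_eqI[where x = "(i, w i)"]) simp_all
  qed
  then have "card {w. hamming_adj n d v w} \<le> card ((\<lambda>(i, a). v(i := a)) ` ({1..d} \<times> {1..n}))"
    by (intro card_mono) auto
  also have "\<dots> \<le> card ({1..d} \<times> {1..n})" by (rule card_image_le) simp
  finally show ?thesis by simp
qed

lemma nbr_sum_ge_imp_open_subset:
  assumes "\<And>v. \<omega> v \<le> 1" "\<theta> \<le> nbr_sum n d \<omega> v"
  shows "\<exists>S\<subseteq>{w. hamming_adj n d v w}. card S = \<theta> \<and> (\<forall>w\<in>S. \<omega> w = 1)"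
proof -
  let ?O = "{w. hamming_adj n d v w \<and> \<omega> w = 1}"
  have "nbr_sum n d \<omega> v = (\<Sum>w | hamming_adj n d v w. if \<omega> w = 1 then 1 else 0)"
    unfolding nbr_sum_def using assms(1) by (intro sum.cong) (auto simp: le_Suc_eq)
  also have "\<dots> = card ?O"
    by (subst sum.inter_filter[symmetric]) auto
  finally have "\<theta> \<le> card ?O" using assms(2) by simp
  then obtain S where "S \<subseteq> ?O" "card S = \<theta>"
    by (rule obtain_subset_with_card_n)
  then show ?thesis by blast
qed

lemma choose_le_power: "N choose k \<le> N ^ k"
proof (cases "k \<le> N")
  case True
  then show ?thesis by (rule binomial_le_pow)
next
  case False
  then show ?thesis by (simp add: binomial_eq_0)
qed

text \<open>The union bound over a vertex and a set of \<open>\<theta>\<close> of its at most \<open>d n\<close> neighbours.\<close>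

lemma prob_threshold_le:
  assumes "0 \<le> p" "p \<le> 1"
  shows "measure_pmf.prob (init_pmf n d p) {\<omega>. \<exists>v\<in>hamming_verts n d. \<theta> \<le> nbr_sum n d \<omega> v}
    \<le> real n ^ d * (real d * real n * p) ^ \<theta>"
proof -
  define M where "M = init_pmf n d p"
  define \<S> where "\<S> v = {S. S \<subseteq> {w. hamming_adj n d v w} \<and> card S = \<theta>}" for v
  have fin\<S>: "finite (\<S> v)" for v
    unfolding \<S>_def by (rule finite_subset[of _ "Pow {w. hamming_adj n d v w}"]) auto
  have card\<S>: "card (\<S> v) \<le> (d * n) ^ \<theta>" for v
  proof -
    have "card (\<S> v) = card {w. hamming_adj n d v w} choose \<theta>"
      unfolding \<S>_def by (rule n_subsets) simp
    also have "\<dots> \<le> card {w. hamming_adj n d v w} ^ \<theta>" by (rule choose_le_power)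
    also have "\<dots> \<le> (d * n) ^ \<theta>" by (intro power_mono card_hamming_nbrs_le) simp
    finally show ?thesis .
  qed
  have "measure_pmf.prob M {\<omega>. \<exists>v\<in>hamming_verts n d. \<theta> \<le> nbr_sum n d \<omega> v}
      \<le> measure_pmf.prob M (\<Union>v\<in>hamming_verts n d. \<Union>S\<in>\<S> v. {\<omega>. \<forall>w\<in>S. \<omega> w = 1})"
  proof (rule prob_mono_on_support)
    fix \<omega> assume "\<omega> \<in> set_pmf M" and "\<omega> \<in> {\<omega>. \<exists>v\<in>hamming_verts n d. \<theta> \<le> nbr_sum n d \<omega> v}"
    then obtain v where v: "v \<in> hamming_verts n d" "\<theta> \<le> nbr_sum n d \<omega> v" by blast
    have "\<omega> w \<le> 1" for w using \<open>\<omega> \<in> set_pmf M\<close> by (simp only: M_def set_init_pmf_le_1)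
    then obtain S where "S \<in> \<S> v" "\<forall>w\<in>S. \<omega> w = 1"
      using nbr_sum_ge_imp_open_subset[of \<omega> \<theta> n d v] v(2) unfolding \<S>_def by blast
    then show "\<omega> \<in> (\<Union>v\<in>hamming_verts n d. \<Union>S\<in>\<S> v. {\<omega>. \<forall>w\<in>S. \<omega> w = 1})"
      using v(1) by blast
  qed
  also have "\<dots> \<le> (\<Sum>v\<in>hamming_verts n d. measure_pmf.prob M (\<Union>S\<in>\<S> v. {\<omega>. \<forall>w\<in>S. \<omega> w = 1}))"
    by (intro measure_pmf.finite_measure_subadditive_finite) auto
  also have "\<dots> \<le> (\<Sum>v\<in>hamming_verts n d. \<Sum>S\<in>\<S> v. measure_pmf.prob M {\<omega>. \<forall>w\<in>S. \<omega> w = 1})"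
    using fin\<S> by (intro sum_mono measure_pmf.finite_measure_subadditive_finite) auto
  also have "\<dots> = (\<Sum>v\<in>hamming_verts n d. \<Sum>S\<in>\<S> v. p ^ \<theta>)"
  proof (intro sum.cong refl)
    fix v S assume "S \<in> \<S> v"
    then have "S \<subseteq> hamming_verts n d" "card S = \<theta>"
      using hamming_nbrs_subset[of n d v] by (auto simp: \<S>_def)
    then show "measure_pmf.prob M {\<omega>. \<forall>w\<in>S. \<omega> w = 1} = p ^ \<theta>"
      using prob_all_open[of S n d p] assms by (simp add: M_def)
  qed
  also have "\<dots> \<le> (\<Sum>v\<in>hamming_verts n d. real ((d * n) ^ \<theta>) * p ^ \<theta>)"
  proof (rule sum_mono)
    fix v
    have "(\<Sum>S\<in>\<S> v. p ^ \<theta>) = real (card (\<S> v)) * p ^ \<theta>" by simp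
    also have "\<dots> \<le> real ((d * n) ^ \<theta>) * p ^ \<theta>"
      using card\<S>[of v] assms(1) by (intro mult_right_mono) (simp_all only: of_nat_le_iff zero_le_power)
    finally show "(\<Sum>S\<in>\<S> v. p ^ \<theta>) \<le> real ((d * n) ^ \<theta>) * p ^ \<theta>" .
  qed
  also have "\<dots> = real n ^ d * (real d * real n * p) ^ \<theta>"
    by (simp add: card_hamming_verts power_mult_distrib)
  finally show ?thesis by (simp add: M_def)
qed

section \<open>The final configuration\<close>

declare One_nat_def [simp del]

lemma bp_final_eq_1_iff:
  assumes "\<And>v. \<omega> v \<le> 1"
  shows "bp_final n d \<theta> \<omega> v = 1 \<longleftrightarrow> (\<exists>j. bp_iter n d \<theta> \<omega> j v = 1)"
proof
  assume "bp_final n d \<theta> \<omega> v = 1"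
  with bp_final_LIMSEQ[of \<omega> n d \<theta> v, OF assms]
  have "(\<lambda>j. bp_iter n d \<theta> \<omega> j v) \<longlonglongrightarrow> 1" by simp
  then have "\<forall>\<^sub>F j in sequentially. 0 < bp_iter n d \<theta> \<omega> j v"
    by (rule order_tendstoD(1)) (rule zero_less_one)
  then obtain j where "0 < bp_iter n d \<theta> \<omega> j v"
    by (auto simp: eventually_sequentially)
  moreover have "bp_iter n d \<theta> \<omega> j v \<le> 1" by (rule bp_iter_le_1) (rule assms)
  ultimately show "\<exists>j. bp_iter n d \<theta> \<omega> j v = 1" by (intro exI[of _ j]) simp
next
  assume "\<exists>j. bp_iter n d \<theta> \<omega> j v = 1"
  then obtain j where j: "bp_iter n d \<theta> \<omega> j v = 1" by blast
  have "bp_iter n d \<theta> \<omega> i v = 1" if "j \<le> i" for i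
  proof (rule antisym)
    show "bp_iter n d \<theta> \<omega> i v \<le> 1" by (rule bp_iter_le_1) (rule assms)
    show "1 \<le> bp_iter n d \<theta> \<omega> i v"
      using incseqD[OF incseq_bp_iter that, of \<omega> n d \<theta> v] assms j by simp
  qed
  then have "(\<lambda>j. bp_iter n d \<theta> \<omega> j v) \<longlonglongrightarrow> 1"
    by (intro tendsto_eventually) (auto simp: eventually_sequentially)
  then show "bp_final n d \<theta> \<omega> v = 1"
    using bp_final_LIMSEQ[of \<omega> n d \<theta> v] assms by (intro LIMSEQ_unique) auto
qed

lemma bp_final_initial:
  assumes "\<And>v. \<omega> v \<le> 1" "\<omega> v = 1"
  shows "bp_final n d \<theta> \<omega> v = 1"
  using assms(2) bp_final_eq_1_iff[of \<omega> n d \<theta> v, OF assms(1)] by (auto simp: bp_iter_def intro: exI[of _ 0])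

text \<open>The final configuration is stable: finitely many vertices that open eventually are all open at some
  common time, and one step later \<open>v\<close> opens. Filling a line then becomes a sequence of applications of
  this rule, without reference to time.\<close>

lemma bp_final_closed:
  assumes le1: "\<And>v. \<omega> v \<le> 1" and W: "finite W" "\<theta> \<le> card W"
    and nb: "\<And>w. w \<in> W \<Longrightarrow> hamming_adj n d v w \<and> bp_final n d \<theta> \<omega> w = 1"
  shows "bp_final n d \<theta> \<omega> v = 1"
proof -
  let ?it = "bp_iter n d \<theta> \<omega>"
  have "\<exists>j. ?it j w = 1" if "w \<in> W" for w
    using nb[OF that] bp_final_eq_1_iff[of \<omega>, OF le1] by blast
  then obtain \<tau> where \<tau>: "\<And>w. w \<in> W \<Longrightarrow> ?it (\<tau> w) w = 1" by metis
  obtain J where J: "\<And>w. w \<in> W \<Longrightarrow> \<tau> w \<le> J"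
    using W(1) by (metis Max_ge finite_imageI imageI)
  have open_J: "1 \<le> ?it J w" if "w \<in> W" for w
    using incseqD[OF incseq_bp_iter J[OF that], of \<omega> n d \<theta> w] le1 \<tau>[OF that] by simp
  have "\<theta> \<le> (\<Sum>w\<in>W. 1)" using W by simp
  also have "\<dots> \<le> (\<Sum>w\<in>W. ?it J w)" using open_J by (intro sum_mono) auto
  also have "\<dots> \<le> nbr_sum n d (?it J) v"
    unfolding nbr_sum_def using nb by (intro sum_mono2) auto
  finally have "?it (Suc J) v = 1" by (simp add: bp_iter_def bp_step_def)
  then show ?thesis using bp_final_eq_1_iff[of \<omega>, OF le1] by blast
qed

lemma hamming_adj_fun_upd:
  assumes "v \<in> hamming_verts n d" "i \<in> {1..d}" "a \<in> {1..n}" "a \<noteq> v i"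
  shows "hamming_adj n d v (v(i := a))"
proof -
  have "{j \<in> {1..d}. v j \<noteq> (v(i := a)) j} = {i}" using assms by auto
  moreover have "v(i := a) \<in> hamming_verts n d"
    using assms PiE_fun_upd[of a "\<lambda>_. {1..n}" i v "{1..d}"] by (simp add: hamming_verts_def insert_absorb)
  ultimately show ?thesis using assms(1) by (simp add: hamming_adj_def)
qed

section \<open>Planes, rows and columns\<close>

definition plane_point :: "(nat \<Rightarrow> nat) \<Rightarrow> nat \<Rightarrow> nat \<Rightarrow> nat \<Rightarrow> nat" where
  "plane_point x t y = x(1 := t, 2 := y)"

definition planes :: "nat \<Rightarrow> nat \<Rightarrow> (nat \<Rightarrow> nat) set" where
  "planes n d = PiE {3..d} (\<lambda>_. {1..n})"

lemma finite_planes: "finite (planes n d)"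
  by (simp add: planes_def finite_PiE)

lemma card_planes: "card (planes n d) = n ^ (d - 2)"
  by (simp add: planes_def card_PiE)

lemma plane_point_in_verts:
  assumes "x \<in> planes n d" "t \<in> {1..n}" "y \<in> {1..n}" "2 \<le> d"
  shows "plane_point x t y \<in> hamming_verts n d"
proof -
  have "{1..d} = insert 2 (insert 1 {3..d})" using assms(4) by auto
  then show ?thesis
    using assms(1-3) unfolding hamming_verts_def planes_def plane_point_def
    by (simp only: PiE_fun_upd)
qed

lemma plane_point_eq_iff: "plane_point x t y = plane_point x t' y' \<longleftrightarrow> t = t' \<and> y = y'"
proof
  assume eq: "plane_point x t y = plane_point x t' y'"
  show "t = t' \<and> y = y'"
    using fun_cong[OF eq, of 1] fun_cong[OF eq, of 2] by (simp add: plane_point_def)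
qed simp

lemma plane_point_same_plane:
  assumes "x \<in> planes n d" "x' \<in> planes n d" "plane_point x t y = plane_point x' t' y'"
  shows "x = x'"
proof (rule PiE_ext)
  show "x \<in> PiE {3..d} (\<lambda>_. {1..n})" "x' \<in> PiE {3..d} (\<lambda>_. {1..n})"
    using assms by (simp_all add: planes_def)
  fix i assume "i \<in> {3..d}"
  then show "x i = x' i" using fun_cong[OF assms(3), of i] by (simp add: plane_point_def)
qed

text \<open>The stability rule inside a plane, with the neighbours split into \<open>T\<close> on the row through the point
  and \<open>R\<close> on its column.\<close>

lemma bp_final_plane_point:
  assumes le1: "\<And>v. \<omega> v \<le> 1" and x: "x \<in> planes n d" and d: "2 \<le> d"
    and T: "T \<subseteq> {1..n} - {t}" and R: "R \<subseteq> {1..n} - {y}" and t: "t \<in> {1..n}" and y: "y \<in> {1..n}"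
    and row: "\<And>s. s \<in> T \<Longrightarrow> bp_final n d \<theta> \<omega> (plane_point x s y) = 1"
    and col: "\<And>r. r \<in> R \<Longrightarrow> bp_final n d \<theta> \<omega> (plane_point x t r) = 1"
    and card: "\<theta> \<le> card T + card R"
  shows "bp_final n d \<theta> \<omega> (plane_point x t y) = 1"
proof (rule bp_final_closed[of \<omega>, OF le1, where W = "(\<lambda>s. plane_point x s y) ` T \<union> (\<lambda>r. plane_point x t r) ` R"])
  have fin: "finite T" "finite R" using T R finite_subset by blast+
  then show "finite ((\<lambda>s. plane_point x s y) ` T \<union> (\<lambda>r. plane_point x t r) ` R)" by simp
  have "card ((\<lambda>s. plane_point x s y) ` T \<union> (\<lambda>r. plane_point x t r) ` R) = card T + card R"
    using fin T R by (subst card_Un_disjoint) (auto simp: card_image inj_on_def plane_point_eq_iff)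
  then show "\<theta> \<le> card ((\<lambda>s. plane_point x s y) ` T \<union> (\<lambda>r. plane_point x t r) ` R)" using card by simp
  have v: "plane_point x t y \<in> hamming_verts n d" using plane_point_in_verts[OF x t y d] .
  have "hamming_adj n d (plane_point x t y) (plane_point x s y)" if "s \<in> T" for s
  proof -
    have eq: "plane_point x s y = (plane_point x t y)(1 := s)" by (auto simp: plane_point_def)
    have "plane_point x t y 1 = t" by (simp add: plane_point_def)
    then show ?thesis
      using that T d unfolding eq by (intro hamming_adj_fun_upd[OF v]) auto
  qed
  moreover have "hamming_adj n d (plane_point x t y) (plane_point x t r)" if "r \<in> R" for r
  proof -
    have eq: "plane_point x t r = (plane_point x t y)(2 := r)" by (auto simp: plane_point_def)
    have "plane_point x t y 2 = y" by (simp add: plane_point_def)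
    then show ?thesis
      using that R d unfolding eq by (intro hamming_adj_fun_upd[OF v]) auto
  qed
  ultimately show "hamming_adj n d (plane_point x t y) w \<and> bp_final n d \<theta> \<omega> w = 1"
    if "w \<in> (\<lambda>s. plane_point x s y) ` T \<union> (\<lambda>r. plane_point x t r) ` R" for w
    using that row col by blast
qed

section \<open>Disjoint blocks of coordinates\<close>

definition block :: "nat \<Rightarrow> nat \<Rightarrow> nat set" where
  "block m j = {j * m<..Suc j * m}"

lemma finite_block: "finite (block m j)" and card_block: "card (block m j) = m"
  by (simp_all add: block_def)

lemma block_subset: "Suc j * m \<le> n \<Longrightarrow> block m j \<subseteq> {1..n}"
  by (auto simp: block_def)

lemma block_unique:
  assumes "z \<in> block m i" "z \<in> block m j" shows "i = j"
proof (rule ccontr)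
  have *: False if "i < j" "z \<in> block m i" "z \<in> block m j" for i j
  proof -
    have "Suc i * m \<le> j * m" using that(1) by (intro mult_le_mono1) simp
    then show False using that(2,3) by (simp add: block_def)
  qed
  assume "i \<noteq> j"
  then show False using assms *[of i j] *[of j i] by linarith
qed

lemma block_disjoint: "i \<noteq> j \<Longrightarrow> block m i \<inter> block m j = {}"
  using block_unique[of _ m i j] by auto

text \<open>Blocks are disjoint, so hits in \<open>a\<close> of them are \<open>a\<close> distinct points.\<close>

lemma transversal:
  assumes hit: "\<forall>i<a. \<exists>r\<in>B i. Q r" and disj: "disjoint_family_on B {..<a}"
  obtains R where "card R = a" "R \<subseteq> (\<Union>i<a. B i)" "\<forall>r\<in>R. Q r"
proof -
  from hit obtain \<rho> where \<rho>: "\<And>i. i < a \<Longrightarrow> \<rho> i \<in> B i \<and> Q (\<rho> i)" by metis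
  have "inj_on \<rho> {..<a}"
  proof (rule inj_onI, rule ccontr)
    fix i j assume "i \<in> {..<a}" "j \<in> {..<a}" "\<rho> i = \<rho> j" "i \<noteq> j"
    then show False using \<rho>[of i] \<rho>[of j] disj by (auto simp: disjoint_family_on_def)
  qed
  then have "card (\<rho> ` {..<a}) = a" by (simp add: card_image)
  then show thesis using \<rho> by (intro that[of "\<rho> ` {..<a}"]) auto
qed

section \<open>Fibres that are hit in every block\<close>

text \<open>The common shape of all ingredients of the construction: \<open>h s\<close> parametrises a line (a row or a
  column of a plane) for each \<open>s\<close>, and some line among those in \<open>S\<close> must have an open point in each of
  the \<open>a\<close> blocks. Asking for one point per block, instead of \<open>a\<close> points anywhere, leaves only unions
  and intersections of independent events.\<close>

definition fibre_hits ::
  "('s \<Rightarrow> 'r \<Rightarrow> 'v) \<Rightarrow> 's set \<Rightarrow> (nat \<Rightarrow> 'r set) \<Rightarrow> nat \<Rightarrow> ('v \<Rightarrow> nat) \<Rightarrow> bool" where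
  "fibre_hits h S B a \<omega> \<longleftrightarrow> (\<exists>s\<in>S. \<forall>i\<in>{..<a}. \<exists>r\<in>B i. \<omega> (h s r) = 1)"

lemma depends_on_fibre_hits:
  assumes "\<And>s i r. s \<in> S \<Longrightarrow> i < a \<Longrightarrow> r \<in> B i \<Longrightarrow> h s r \<in> A"
  shows "depends_on A (fibre_hits h S B a)"
  unfolding fibre_hits_def[abs_def]
proof (intro depends_on_Bex depends_on_Ball)
  fix s i r assume "s \<in> S" "i \<in> {..<a}" "r \<in> B i"
  then show "depends_on A (\<lambda>\<omega>. \<omega> (h s r) = 1)"
    using assms by (intro depends_on_mono[OF depends_on_value]) simp
qed

text \<open>A block of size \<open>m\<close> contains an open point with probability at least \<open>min 1 (m p) / 2\<close>, hence a given
  line is hit in all \<open>a\<close> blocks with probability at least the \<open>a\<close>-th power of this, and \<open>m\<close> independent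
  lines are available.\<close>

lemma prob_fibre_hits_ge:
  fixes h :: "'s \<Rightarrow> 'r \<Rightarrow> nat \<Rightarrow> nat"
  assumes p: "0 \<le> p" "p \<le> 1"
    and inj: "\<And>s r s' r'. h s r = h s' r' \<Longrightarrow> s = s' \<and> r = r'"
    and S: "finite S" "card S = m"
    and B: "\<And>i. i < a \<Longrightarrow> finite (B i)" "\<And>i. i < a \<Longrightarrow> card (B i) = m"
    and disj: "disjoint_family_on B {..<a}"
    and verts: "\<And>s i r. s \<in> S \<Longrightarrow> i < a \<Longrightarrow> r \<in> B i \<Longrightarrow> h s r \<in> hamming_verts n d"
  shows "1 - exp (- (real m * (min 1 (real m * p) / 2) ^ a))
    \<le> measure_pmf.prob (init_pmf n d p) {\<omega>. fibre_hits h S B a \<omega>}"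
proof -
  define P where "P E = measure_pmf.prob (init_pmf n d p) {\<omega>. E \<omega>}" for E
  have hit: "min 1 (real m * p) / 2 \<le> P (\<lambda>\<omega>. \<exists>r\<in>B i. \<omega> (h s r) = 1)" if "s \<in> S" "i < a" for s i
  proof -
    have "min 1 (real m * p) / 2 \<le> 1 - exp (- (real (card (B i)) * p))"
      using one_minus_exp_ge[of "real m * p"] p B(2)[OF that(2)] by simp
    also have "\<dots> \<le> P (\<lambda>\<omega>. \<exists>r\<in>B i. \<omega> (h s r) = 1)"
      unfolding P_def init_pmf_def
    proof (rule prob_Bex_indep_ge[where A = "\<lambda>r. {h s r}"])
      show "disjoint_family_on (\<lambda>r. {h s r}) (B i)"
        using inj by (auto simp: disjoint_family_on_def)
      show "p \<le> measure_pmf.prob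
          (Pi_pmf (hamming_verts n d) (0::nat) (\<lambda>_. map_pmf of_bool (bernoulli_pmf p))) {\<omega>. \<omega> (h s r) = 1}"
        if "r \<in> B i" for r
        using prob_open[OF verts[OF \<open>s \<in> S\<close> \<open>i < a\<close> that] p] by (simp add: init_pmf_def)
    qed (use B that in \<open>simp_all only: depends_on_value finite_hamming_verts\<close>)
    finally show ?thesis .
  qed
  have dep: "depends_on (h s ` B i) (\<lambda>\<omega>. \<exists>r\<in>B i. \<omega> (h s r) = 1)" for s i
    by (intro depends_on_Bex depends_on_mono[OF depends_on_value]) simp
  have fibre: "(min 1 (real m * p) / 2) ^ a \<le> P (\<lambda>\<omega>. \<forall>i\<in>{..<a}. \<exists>r\<in>B i. \<omega> (h s r) = 1)" if "s \<in> S" for s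
  proof -
    have "P (\<lambda>\<omega>. \<forall>i\<in>{..<a}. \<exists>r\<in>B i. \<omega> (h s r) = 1) = (\<Prod>i<a. P (\<lambda>\<omega>. \<exists>r\<in>B i. \<omega> (h s r) = 1))"
      unfolding P_def init_pmf_def
    proof (rule prob_Ball_indep[where A = "\<lambda>i. h s ` B i"])
      show "disjoint_family_on (\<lambda>i. h s ` B i) {..<a}"
        using disj inj unfolding disjoint_family_on_def by blast
    qed (use dep in simp_all)
    moreover have "(\<Prod>i<a. min 1 (real m * p) / 2) \<le> (\<Prod>i<a. P (\<lambda>\<omega>. \<exists>r\<in>B i. \<omega> (h s r) = 1))"
      using hit[OF that] p by (intro prod_mono) auto
    ultimately show ?thesis by simp
  qed
  have "1 - exp (- (real (card S) * (min 1 (real m * p) / 2) ^ a)) \<le> P (fibre_hits h S B a)"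
    unfolding P_def init_pmf_def fibre_hits_def
  proof (rule prob_Bex_indep_ge[where A = "\<lambda>s. range (h s)"])
    show "disjoint_family_on (\<lambda>s. range (h s)) S"
      using inj by (auto simp: disjoint_family_on_def)
    show "depends_on (range (h s)) (\<lambda>\<omega>. \<forall>i\<in>{..<a}. \<exists>r\<in>B i. \<omega> (h s r) = 1)" for s
      by (rule depends_on_Ball, rule depends_on_mono[OF dep]) auto
    show "(min 1 (real m * p) / 2) ^ a \<le> measure_pmf.prob
          (Pi_pmf (hamming_verts n d) (0::nat) (\<lambda>_. map_pmf of_bool (bernoulli_pmf p)))
          {\<omega>. \<forall>i\<in>{..<a}. \<exists>r\<in>B i. \<omega> (h s r) = 1}" if "s \<in> S" for s
      using fibre[OF that] by (simp add: P_def init_pmf_def)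
  qed (use S in simp_all)
  then show ?thesis by (simp add: P_def S(2))
qed

section \<open>A good plane fills a line\<close>

text \<open>The three conditions give, in this order, a row with \<open>k\<close> open points, a column that opens its
  crossing with this row, and \<open>\<theta>\<close> columns that open their crossings with the row once \<open>k + 1\<close> of its
  points are open. Rows are taken from block 0 and the open points of columns from blocks
  \<open>1, \<dots>, \<theta> - k\<close>, so these points are off the row. The columns are taken from the blocks
  \<open>\<theta>, \<dots>, 2 \<theta>\<close>, away from the blocks \<open>0, \<dots>, k - 1\<close> that hold the \<open>k\<close> open points of the row: no
  point is used twice, and the conditions depend on disjoint sets of vertices.\<close>

definition good_plane :: "nat \<Rightarrow> nat \<Rightarrow> nat \<Rightarrow> (nat \<Rightarrow> nat) \<Rightarrow> config \<Rightarrow> bool" where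
  "good_plane \<theta> k m x \<omega> \<longleftrightarrow>
     fibre_hits (\<lambda>y t. plane_point x t y) (block m 0) (block m) k \<omega> \<and>
     fibre_hits (\<lambda>t y. plane_point x t y) (block m \<theta>) (\<lambda>i. block m (Suc i)) (\<theta> - k) \<omega> \<and>
     (\<forall>j\<in>{..<\<theta>}. fibre_hits (\<lambda>t y. plane_point x t y) (block m (\<theta> + 1 + j)) (\<lambda>i. block m (Suc i)) (\<theta> - k - 1) \<omega>)"

lemma block_in_range: "(2 * \<theta> + 1) * m \<le> n \<Longrightarrow> j \<le> 2 * \<theta> \<Longrightarrow> block m j \<subseteq> {1..n}"
  by (rule block_subset, rule order_trans[of _ "(2 * \<theta> + 1) * m"], rule mult_le_mono1) auto

lemma disjoint_blocks: "inj_on f I \<Longrightarrow> disjoint_family_on (\<lambda>i. block m (f i)) I"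
  unfolding disjoint_family_on_def by (intro ballI impI block_disjoint) (simp add: inj_on_eq_iff)

text \<open>The first column opens its crossing with the row because \<open>k + (\<theta> - k) = \<theta>\<close>. Each of the \<open>\<theta>\<close> further
  columns then opens its crossing because \<open>(k + 1) + (\<theta> - k - 1) = \<theta>\<close>, and these \<open>\<theta>\<close> points open all
  other points of the row.\<close>

lemma good_plane_fills_line:
  assumes le1: "\<And>v. \<omega> v \<le> 1" and x: "x \<in> planes n d" and d: "2 \<le> d"
    and k: "k < \<theta>" and m: "(2 * \<theta> + 1) * m \<le> n" and good: "good_plane \<theta> k m x \<omega>"
  shows "\<exists>l. hamming_line n d l \<and> (\<forall>v\<in>l. bp_final n d \<theta> \<omega> v = 1)"
proof -
  let ?F = "\<lambda>t y. bp_final n d \<theta> \<omega> (plane_point x t y) = 1"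
  note blk = block_in_range[OF m]
  have init: "?F t y" if "\<omega> (plane_point x t y) = 1" for t y
    using bp_final_initial[of \<omega>, OF le1 that] .
  obtain y where y: "y \<in> block m 0" and "\<forall>i<k. \<exists>t\<in>block m i. \<omega> (plane_point x t y) = 1"
    using good by (auto simp: good_plane_def fibre_hits_def simp del: One_nat_def)
  from transversal[OF this(2) disjoint_blocks[OF inj_on_id2]]
  obtain T where T: "card T = k" "T \<subseteq> (\<Union>i<k. block m i)" "\<forall>t\<in>T. \<omega> (plane_point x t y) = 1" .
  have "(\<Union>i<k. block m i) \<subseteq> {1..n}"
    using k by (intro UN_least blk) simp
  with T(2) have T_range: "T \<subseteq> {1..n}" by (rule subset_trans)
  have y_range: "y \<in> {1..n}" using subsetD[OF blk y] by simp
  have column: "\<exists>t R. t \<in> block m b \<and> t \<notin> T \<and> t \<in> {1..n} \<and> R \<subseteq> {1..n} - {y} \<and> card R = a \<and> (\<forall>r\<in>R. ?F t r)"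
    if hits: "fibre_hits (\<lambda>t y. plane_point x t y) (block m b) (\<lambda>i. block m (Suc i)) a \<omega>"
      and b: "k \<le> b" "b \<le> 2 * \<theta>" and a: "a \<le> \<theta>" for a b
  proof -
    obtain t where t: "t \<in> block m b" and "\<forall>i<a. \<exists>r\<in>block m (Suc i). \<omega> (plane_point x t r) = 1"
      using hits by (auto simp: fibre_hits_def simp del: One_nat_def)
    from transversal[OF this(2) disjoint_blocks[OF inj_Suc[THEN inj_on_subset, OF subset_UNIV]]]
    obtain R where R: "card R = a" "R \<subseteq> (\<Union>i<a. block m (Suc i))" "\<forall>r\<in>R. \<omega> (plane_point x t r) = 1" .
    have "(\<Union>i<a. block m (Suc i)) \<subseteq> {1..n}"
      using a k by (intro UN_least blk) simp
    with R(2) have "R \<subseteq> {1..n}" by (rule subset_trans)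
    moreover have "y \<notin> R"
    proof
      assume "y \<in> R"
      then obtain i where "y \<in> block m (Suc i)" using R(2) by blast
      from block_unique[OF y this] show False by simp
    qed
    moreover have "t \<notin> T"
    proof
      assume "t \<in> T"
      then obtain i where "i < k" "t \<in> block m i" using T(2) by blast
      from this(1) block_unique[OF t this(2)] b(1) show False by simp
    qed
    moreover have "t \<in> {1..n}" using t blk[OF b(2)] by blast
    ultimately show ?thesis using t R(1,3) init by (intro exI[of _ t] exI[of _ R]) blast
  qed
  obtain t\<^sub>0 R\<^sub>0 where t0: "t\<^sub>0 \<in> block m \<theta>" "t\<^sub>0 \<notin> T" "t\<^sub>0 \<in> {1..n}"
    and R0: "R\<^sub>0 \<subseteq> {1..n} - {y}" "card R\<^sub>0 = \<theta> - k" "\<forall>r\<in>R\<^sub>0. ?F t\<^sub>0 r"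
    using column[of \<theta> "\<theta> - k"] good k by (auto simp: good_plane_def)
  have F0: "?F t\<^sub>0 y"
    by (rule bp_final_plane_point[of \<omega>, OF le1 x d, where T = T and R = R\<^sub>0])
      (use T T_range t0 y_range R0 k init in auto)
  have "\<exists>t\<in>block m (\<theta> + 1 + j). t \<in> {1..n} \<and> ?F t y" if "j < \<theta>" for j
  proof -
    have "fibre_hits (\<lambda>t y. plane_point x t y) (block m (\<theta> + 1 + j)) (\<lambda>i. block m (Suc i)) (\<theta> - k - 1) \<omega>"
      using good that unfolding good_plane_def by blast
    from column[OF this] k that
    have "\<exists>t R. t \<in> block m (\<theta> + 1 + j) \<and> t \<notin> T \<and> t \<in> {1..n} \<and> R \<subseteq> {1..n} - {y} \<and>
          card R = \<theta> - k - 1 \<and> (\<forall>r\<in>R. ?F t r)" by simp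
    then obtain t R where t: "t \<in> block m (\<theta> + 1 + j)" "t \<notin> T" "t \<in> {1..n}"
      and R: "R \<subseteq> {1..n} - {y}" "card R = \<theta> - k - 1" "\<forall>r\<in>R. ?F t r" by blast
    have "t \<noteq> t\<^sub>0" using t(1) t0(1) block_unique[of t m "\<theta> + 1 + j" \<theta>] by auto
    have "finite T" using T_range finite_subset by blast
    then have card: "card (insert t\<^sub>0 T) = Suc k" using t0(2) T(1) by simp
    have "?F t y"
      by (rule bp_final_plane_point[of \<omega>, OF le1 x d, where T = "insert t\<^sub>0 T" and R = R])
        (use T T_range t0 y_range R k t card F0 init \<open>t \<noteq> t\<^sub>0\<close> in auto)
    then show ?thesis using t by blast
  qed
  then have hits: "\<forall>j<\<theta>. \<exists>t\<in>block m (\<theta> + 1 + j). t \<in> {1..n} \<and> ?F t y" by blast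
  have "inj_on (\<lambda>j. \<theta> + 1 + j) {..<\<theta>}" by (simp add: inj_on_def)
  from transversal[OF hits disjoint_blocks[OF this]]
  obtain U where "card U = \<theta>" "\<forall>t\<in>U. t \<in> {1..n} \<and> ?F t y" .
  note U = this
  have row: "?F t y" if "t \<in> {1..n}" for t
  proof (cases "t \<in> U")
    case False
    show ?thesis
      by (rule bp_final_plane_point[of \<omega>, OF le1 x d, where T = U and R = "{}"])
        (use U False that y_range in auto)
  qed (use U in blast)
  let ?l = "{v \<in> hamming_verts n d. \<forall>j\<in>{1..d} - {1}. v j = plane_point x t\<^sub>0 y j}"
  have "hamming_line n d ?l"
    unfolding hamming_line_def using plane_point_in_verts[OF x t0(3) y_range d] d
    by (intro bexI[of _ 1] bexI[of _ "plane_point x t\<^sub>0 y"]) auto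
  moreover have "bp_final n d \<theta> \<omega> v = 1" if "v \<in> ?l" for v
  proof -
    have v1: "v 1 \<in> {1..n}" using that d by (auto simp: hamming_verts_def)
    have "v = plane_point x (v 1) y"
    proof (rule PiE_ext)
      show "v \<in> PiE {1..d} (\<lambda>_. {1..n})" using that by (simp add: hamming_verts_def)
      show "plane_point x (v 1) y \<in> PiE {1..d} (\<lambda>_. {1..n})"
        using plane_point_in_verts[OF x v1 y_range d] by (simp add: hamming_verts_def)
      fix j assume "j \<in> {1..d}"
      then show "v j = plane_point x (v 1) y j" using that by (cases "j = 1") (auto simp: plane_point_def)
    qed
    then show ?thesis using row[OF v1] by simp
  qed
  ultimately show ?thesis by blast
qed

section \<open>The probability of a good plane\<close>

lemma depends_on_good_plane:
  "depends_on {plane_point x t y | t y. True} (good_plane \<theta> k m x)"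
  unfolding good_plane_def[abs_def]
  by (intro depends_on_conj depends_on_Ball depends_on_fibre_hits) auto

text \<open>The conditions involve disjoint slabs of the plane, so their probabilities multiply.\<close>

lemma prob_good_plane_ge:
  assumes p: "0 \<le> p" "p \<le> 1" and x: "x \<in> planes n d" and d: "2 \<le> d"
    and k: "k < \<theta>" and m: "(2 * \<theta> + 1) * m \<le> n"
  defines "u \<equiv> min 1 (real m * p) / 2"
  shows "(1 - exp (- (real m * u ^ k))) * ((1 - exp (- (real m * u ^ (\<theta> - k)))) *
           (1 - exp (- (real m * u ^ (\<theta> - k - 1)))) ^ \<theta>)
    \<le> measure_pmf.prob (init_pmf n d p) {\<omega>. good_plane \<theta> k m x \<omega>}"
proof -
  define P where "P E = measure_pmf.prob (init_pmf n d p) {\<omega>. E \<omega>}" for E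
  define slab where "slab b = {plane_point x t y | t y. t \<in> block m b}" for b
  define G where "G = fibre_hits (\<lambda>y t. plane_point x t y) (block m 0) (block m) k"
  define F where "F b a = fibre_hits (\<lambda>t y. plane_point x t y) (block m b) (\<lambda>i. block m (Suc i)) a" for b a
  note blk = block_in_range[OF m]
  have depG: "depends_on (\<Union>i<k. slab i) G"
    unfolding G_def slab_def by (rule depends_on_fibre_hits) auto
  have depF: "depends_on (slab b) (F b a)" for b a
    unfolding F_def slab_def by (rule depends_on_fibre_hits) auto
  have slab_disj: "slab i \<inter> slab j = {}" if "i \<noteq> j" for i j
    using block_disjoint[OF that, of m] by (auto simp: slab_def plane_point_eq_iff)
  have PG: "1 - exp (- (real m * u ^ k)) \<le> P G"
    unfolding P_def G_def u_def
  proof (rule prob_fibre_hits_ge[OF p])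
    show "disjoint_family_on (block m) {..<k}" by (rule disjoint_blocks[OF inj_on_id2])
    show "plane_point x t y \<in> hamming_verts n d" if "y \<in> block m 0" "i < k" "t \<in> block m i" for y i t
      using that k by (intro plane_point_in_verts[OF x _ _ d] subsetD[OF blk that(1)] subsetD[OF blk that(3)]) auto
  qed (simp_all add: plane_point_eq_iff finite_block card_block)
  have PF: "1 - exp (- (real m * u ^ a)) \<le> P (F b a)" if "b \<le> 2 * \<theta>" "a \<le> \<theta>" for a b
    unfolding P_def F_def u_def
  proof (rule prob_fibre_hits_ge[OF p])
    show "disjoint_family_on (\<lambda>i. block m (Suc i)) {..<a}" by (intro disjoint_blocks) simp
    show "plane_point x t y \<in> hamming_verts n d" if t: "t \<in> block m b" and "i < a" and y: "y \<in> block m (Suc i)" for t i y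
      using \<open>b \<le> 2 * \<theta>\<close> \<open>a \<le> \<theta>\<close> \<open>i < a\<close> k
      by (intro plane_point_in_verts[OF x _ _ d] subsetD[OF blk t] subsetD[OF blk y]) auto
  qed (simp_all add: plane_point_eq_iff finite_block card_block)
  have u0: "0 \<le> u" using p by (simp add: u_def)
  then have nonneg: "0 \<le> 1 - exp (- (real m * u ^ a))" for a by simp
  let ?H = "\<lambda>\<omega>. \<forall>j\<in>{..<\<theta>}. F (\<theta> + 1 + j) (\<theta> - k - 1) \<omega>"
  have depH: "depends_on (\<Union>j<\<theta>. slab (\<theta> + 1 + j)) ?H"
    by (rule depends_on_Ball, rule depends_on_mono[OF depF]) auto
  have "P ?H = (\<Prod>j<\<theta>. P (F (\<theta> + 1 + j) (\<theta> - k - 1)))"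
    unfolding P_def init_pmf_def
    by (rule prob_Ball_indep[where A = "\<lambda>j. slab (\<theta> + 1 + j)"])
      (auto simp: disjoint_family_on_def intro!: depF slab_disj)
  moreover have "(\<Prod>j<\<theta>. 1 - exp (- (real m * u ^ (\<theta> - k - 1)))) \<le> (\<Prod>j<\<theta>. P (F (\<theta> + 1 + j) (\<theta> - k - 1)))"
    using nonneg by (intro prod_mono conjI PF) auto
  ultimately have PH: "(1 - exp (- (real m * u ^ (\<theta> - k - 1)))) ^ \<theta> \<le> P ?H" by simp
  have depFH: "depends_on (\<Union>b\<in>{\<theta>..}. slab b) (\<lambda>\<omega>. F \<theta> (\<theta> - k) \<omega> \<and> ?H \<omega>)"
  proof (rule depends_on_conj)
    show "depends_on (\<Union>b\<in>{\<theta>..}. slab b) (F \<theta> (\<theta> - k))"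
      by (rule depends_on_mono[OF depF]) auto
    have "(\<Union>j<\<theta>. slab (\<theta> + 1 + j)) \<subseteq> (\<Union>b\<in>{\<theta>..}. slab b)"
      by (intro UN_least UN_upper) simp
    then show "depends_on (\<Union>b\<in>{\<theta>..}. slab b) ?H" by (rule depends_on_mono[OF depH])
  qed
  have disj1: "slab \<theta> \<inter> (\<Union>j<\<theta>. slab (\<theta> + 1 + j)) = {}"
  proof -
    have "slab \<theta> \<inter> slab (\<theta> + 1 + j) = {}" for j by (rule slab_disj) simp
    then show ?thesis by blast
  qed
  have "slab i \<inter> slab b = {}" if "i < k" "\<theta> \<le> b" for i b
    using k that by (intro slab_disj) simp
  then have disj2: "(\<Union>i<k. slab i) \<inter> (\<Union>b\<in>{\<theta>..}. slab b) = {}" by blast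
  have "P (good_plane \<theta> k m x) = P (\<lambda>\<omega>. G \<omega> \<and> F \<theta> (\<theta> - k) \<omega> \<and> ?H \<omega>)"
    by (simp add: good_plane_def[abs_def] G_def F_def)
  also have "\<dots> = P G * (P (F \<theta> (\<theta> - k)) * P ?H)"
    unfolding P_def init_pmf_def
    by (simp only: prob_conj_indep[OF finite_hamming_verts depG depFH disj2]
        prob_conj_indep[OF finite_hamming_verts depF depH disj1])
  also have "(1 - exp (- (real m * u ^ k))) * ((1 - exp (- (real m * u ^ (\<theta> - k)))) *
           (1 - exp (- (real m * u ^ (\<theta> - k - 1)))) ^ \<theta>) \<le> \<dots>"
    using nonneg PG PF[of \<theta> "\<theta> - k"] PH
    by (intro mult_mono mult_nonneg_nonneg zero_le_power) (auto simp: P_def)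
  finally show ?thesis by (simp add: P_def)
qed

text \<open>Distinct planes are disjoint, hence independent, and there are \<open>n ^ (d - 2)\<close> of them.\<close>

lemma prob_line_filled_ge:
  assumes p: "0 \<le> p" "p \<le> 1" and d: "2 \<le> d" and k: "k < \<theta>" and m: "(2 * \<theta> + 1) * m \<le> n"
  defines "u \<equiv> min 1 (real m * p) / 2"
  shows "1 - exp (- (real n ^ (d - 2) *
          ((1 - exp (- (real m * u ^ k))) * ((1 - exp (- (real m * u ^ (\<theta> - k)))) *
           (1 - exp (- (real m * u ^ (\<theta> - k - 1)))) ^ \<theta>))))
    \<le> measure_pmf.prob (init_pmf n d p)
        {\<omega>. \<exists>l. hamming_line n d l \<and> (\<forall>v \<in> l. bp_final n d \<theta> \<omega> v = 1)}"
    (is "1 - exp (- (_ * ?q)) \<le> _")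
proof -
  have "1 - exp (- (real (card (planes n d)) * ?q))
      \<le> measure_pmf.prob (init_pmf n d p) {\<omega>. \<exists>x\<in>planes n d. good_plane \<theta> k m x \<omega>}"
    unfolding init_pmf_def
  proof (rule prob_Bex_indep_ge[where A = "\<lambda>x. {plane_point x t y | t y. True}"])
    show "disjoint_family_on (\<lambda>x. {plane_point x t y | t y. True}) (planes n d)"
      unfolding disjoint_family_on_def using plane_point_same_plane by blast
    show "?q \<le> measure_pmf.prob
        (Pi_pmf (hamming_verts n d) (0::nat) (\<lambda>_. map_pmf of_bool (bernoulli_pmf p))) {\<omega>. good_plane \<theta> k m x \<omega>}"
      if "x \<in> planes n d" for x
      using prob_good_plane_ge[OF p that d k m] by (simp add: init_pmf_def u_def)
  qed (simp_all only: depends_on_good_plane finite_planes finite_hamming_verts)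
  also have "\<dots> \<le> measure_pmf.prob (init_pmf n d p)
        {\<omega>. \<exists>l. hamming_line n d l \<and> (\<forall>v \<in> l. bp_final n d \<theta> \<omega> v = 1)}"
  proof (rule prob_mono_on_support)
    fix \<omega> assume \<omega>: "\<omega> \<in> set_pmf (init_pmf n d p)" and "\<omega> \<in> {\<omega>. \<exists>x\<in>planes n d. good_plane \<theta> k m x \<omega>}"
    then obtain x where "x \<in> planes n d" "good_plane \<theta> k m x \<omega>" by blast
    moreover have "\<omega> v \<le> 1" for v using set_init_pmf_le_1[OF \<omega>] .
    ultimately show "\<omega> \<in> {\<omega>. \<exists>l. hamming_line n d l \<and> (\<forall>v \<in> l. bp_final n d \<theta> \<omega> v = 1)}"
      using good_plane_fills_line[of \<omega> x n d k \<theta> m] d k m by blast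
  qed
  finally show ?thesis by (simp add: card_planes)
qed

section \<open>Growth of the number of good planes\<close>

lemma filterlim_min_at_top:
  fixes f g :: "'a \<Rightarrow> 'b :: linorder"
  assumes "filterlim f at_top F" "filterlim g at_top F"
  shows "filterlim (\<lambda>x. min (f x) (g x)) at_top F"
  using assms unfolding filterlim_at_top by (auto intro: eventually_conj)

text \<open>The number \<open>k\<close> is the largest integer with \<open>d k \<le> (d - 1) \<theta>\<close>. The upper bound on \<open>k\<close> keeps
  the expected number of lines with \<open>k\<close> open points at order \<open>f ^ k\<close> or more, and \<open>\<theta> \<le> d k\<close> does the same
  for the number of planes with a vertex that has \<open>\<theta> - k\<close> open neighbours in its column. The
  latter follows from \<open>2 \<theta> + d \<le> d \<theta> + 1\<close>, and this is where \<open>d\<close> and \<open>\<theta>\<close> must be large enough.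
  Maximality of \<open>k\<close> gives the last inequality, which makes \<open>n (n p) ^ (\<theta> - k - 1)\<close> diverge.\<close>

lemma exponent_choice:
  fixes d \<theta> :: nat
  assumes "3 \<le> d" "3 \<le> \<theta>"
  defines "k \<equiv> ((d - 1) * \<theta>) div d"
  shows "1 \<le> k" "k < \<theta>" "d * k \<le> (d - 1) * \<theta>" "\<theta> \<le> d * k" "d * (\<theta> - k - 1) < \<theta>"
proof -
  have dt: "(d - 1) * \<theta> + \<theta> = d * \<theta>" using assms(1) by (cases d) simp_all
  show le: "d * k \<le> (d - 1) * \<theta>" by (simp add: k_def)
  have lt: "(d - 1) * \<theta> < d * k + d"
    using assms(1) mult_div_mod_eq[of d "(d - 1) * \<theta>"] mod_less_divisor[of d "(d - 1) * \<theta>"]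
    unfolding k_def by linarith
  have "d * k < d * \<theta>" using le dt assms(2) by linarith
  then show k\<theta>: "k < \<theta>" by simp
  obtain e where e: "\<theta> = k + 1 + e" using k\<theta> less_iff_Suc_add[of k \<theta>] by auto
  have "d * \<theta> = d * k + d + d * e" unfolding e by (simp add: algebra_simps)
  then have "d * e < \<theta>" using lt dt by linarith
  then show "d * (\<theta> - k - 1) < \<theta>" using e by simp
  obtain d' where d': "d = d' + 3" using assms(1) by (metis add.commute le_Suc_ex)
  obtain h where h: "\<theta> = h + 3" using assms(2) by (metis add.commute le_Suc_ex)
  have "2 * \<theta> + d \<le> d * \<theta> + 1" unfolding d' h by (simp add: algebra_simps)
  then show k1: "\<theta> \<le> d * k" using lt dt by linarith
  then show "1 \<le> k" using assms(2) by (cases k) auto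
qed

text \<open>Here \<open>z = n powr (1 / \<theta>)\<close>, so that only integer powers of \<open>z\<close> occur, \<open>M\<close> is the block size and \<open>u\<close>
  the lower bound for the probability that a block is hit. A product of two minima with 1 is one of
  \<open>1\<close>, \<open>M u^k\<close>, \<open>M u^(\<theta> - k)\<close> and \<open>M\<^sup>2 u^\<theta>\<close>. After multiplication by the number of planes, the first is
  at least \<open>n\<close> because \<open>d \<ge> 3\<close>, the second and third are at least \<open>c g\<close> by the exponent inequalities,
  and in the fourth the powers of \<open>z\<close> cancel exactly: this is the critical scaling, where only \<open>g\<close>
  is left.\<close>

lemma plane_count_growth:
  fixes z g c M u :: real
  assumes z: "1 \<le> z" and g: "1 \<le> g" and c: "0 < c" "c \<le> 1"
    and M: "c * z ^ \<theta> \<le> M" and u: "g / z ^ d \<le> u" and d: "3 \<le> d"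
    and k: "1 \<le> k" "k < \<theta>" "d * k \<le> (d - 1) * \<theta>" "\<theta> \<le> d * k" "d * (\<theta> - k - 1) < \<theta>"
  shows "min (z ^ \<theta>) (c\<^sup>2 * g) \<le> (z ^ \<theta>) ^ (d - 2) * (min 1 (M * u ^ k) * min 1 (M * u ^ (\<theta> - k)))"
    and "c * z \<le> M * u ^ (\<theta> - k - 1)"
proof -
  have M0: "0 \<le> M" and u0: "0 \<le> u"
    using M u z g c by (meson order_trans mult_nonneg_nonneg zero_le_power divide_nonneg_nonneg
        zero_le_one less_imp_le)+
  have scale: "c * g ^ a * z ^ s \<le> z ^ r * (M * u ^ a)" if "s + d * a \<le> r + \<theta>" for a s r
  proof -
    have "z ^ s * z ^ (d * a) \<le> z ^ r * z ^ \<theta>"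
      using that z by (simp add: power_add[symmetric] power_increasing)
    then have "z ^ s \<le> z ^ r * z ^ \<theta> / z ^ (d * a)" using z by (simp add: field_simps)
    then have "c * g ^ a * z ^ s \<le> c * g ^ a * (z ^ r * z ^ \<theta> / z ^ (d * a))"
      using c g by (intro mult_left_mono) auto
    also have "\<dots> = z ^ r * (c * z ^ \<theta> * (g / z ^ d) ^ a)"
      by (simp add: power_divide power_mult)
    also have "\<dots> \<le> z ^ r * (M * u ^ a)"
      using M u M0 c z g by (intro mult_left_mono mult_mono power_mono) auto
    finally show ?thesis .
  qed
  have g_pow: "g \<le> g ^ a" if "1 \<le> a" for a using that g by (intro self_le_power) simp_all
  have cg: "c\<^sup>2 * g \<le> c * g ^ a" if "1 \<le> a" for a
  proof (rule mult_mono)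
    show "c\<^sup>2 \<le> c" using c by (simp add: power2_eq_square mult_left_le)
  qed (use g_pow[OF that] c g in auto)
  show "c * z \<le> M * u ^ (\<theta> - k - 1)"
  proof -
    have "c * z * 1 \<le> c * z * g ^ (\<theta> - k - 1)"
      using c z g by (intro mult_left_mono one_le_power) auto
    also have "\<dots> \<le> M * u ^ (\<theta> - k - 1)"
      using scale[of 1 "\<theta> - k - 1" 0] k(5) by (simp add: mult.assoc mult.commute[of z])
    finally show ?thesis by simp
  qed
  define N where "N = z ^ ((d - 2) * \<theta>)"
  have N: "(z ^ \<theta>) ^ (d - 2) = N" by (simp add: N_def power_mult[symmetric] mult.commute)
  have d2: "(d - 2) * \<theta> + \<theta> = (d - 1) * \<theta>"
  proof -
    have "d - 1 = (d - 2) + 1" using d by simp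
    then show ?thesis by (simp only: distrib_right mult_1)
  qed
  have "c * g ^ k * z ^ 0 \<le> N * (M * u ^ k)"
    unfolding N_def using k d2 by (intro scale) simp
  then have A1: "c\<^sup>2 * g \<le> N * (M * u ^ k)" using cg[OF k(1)] by simp
  have "d * (\<theta> - k) \<le> (d - 1) * \<theta>"
    using k(4) d by (simp add: diff_mult_distrib2 diff_mult_distrib)
  then have "c * g ^ (\<theta> - k) * z ^ 0 \<le> N * (M * u ^ (\<theta> - k))"
    unfolding N_def using d2 by (intro scale) simp
  moreover have "1 \<le> \<theta> - k" using k(2) by simp
  ultimately have A2: "c\<^sup>2 * g \<le> N * (M * u ^ (\<theta> - k))" using cg by fastforce
  have A12: "c\<^sup>2 * g \<le> N * (M * u ^ k * (M * u ^ (\<theta> - k)))"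
  proof -
    have "c\<^sup>2 * g \<le> c * (c * g ^ \<theta> * z ^ 0)"
      using g_pow[of \<theta>] k(2) c by (simp add: power2_eq_square)
    also have "\<dots> \<le> c * (z ^ ((d - 1) * \<theta>) * (M * u ^ \<theta>))"
      using c d by (intro mult_left_mono scale) (simp_all add: diff_mult_distrib)
    also have "\<dots> = N * (c * z ^ \<theta>) * (M * u ^ \<theta>)"
      unfolding N_def d2[symmetric] by (simp add: power_add)
    also have "\<dots> \<le> N * M * (M * u ^ \<theta>)"
      using M M0 u0 z by (intro mult_right_mono mult_left_mono) (auto simp: N_def)
    also have "u ^ \<theta> = u ^ k * u ^ (\<theta> - k)" using k(2) by (simp add: power_add[symmetric])
    finally show ?thesis by (simp add: mult_ac)
  qed
  have A0: "z ^ \<theta> \<le> N"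
    unfolding N_def using z d by (intro power_increasing) (auto simp: Suc_le_eq)
  show "min (z ^ \<theta>) (c\<^sup>2 * g) \<le> (z ^ \<theta>) ^ (d - 2) * (min 1 (M * u ^ k) * min 1 (M * u ^ (\<theta> - k)))"
    unfolding N min_def[of 1] using A0 A1 A2 A12 by auto
qed

section \<open>The threshold\<close>

lemma critical_scale:
  assumes "1 \<le> n" "0 < \<theta>"
  defines "z \<equiv> real n powr (1 / real \<theta>)"
  shows "1 \<le> z" "z ^ \<theta> = real n" "real n powr (- 1 - real d / real \<theta>) = 1 / (z ^ \<theta> * z ^ d)"
proof -
  show "1 \<le> z" unfolding z_def using assms by (intro ge_one_powr_ge_zero) auto
  have zpow: "z ^ a = real n powr (real a / real \<theta>)" for a
    using assms by (simp add: z_def powr_realpow[symmetric] powr_powr)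
  show "z ^ \<theta> = real n" using zpow[of \<theta>] assms(1,2) by simp
  have "real n powr (- 1 - real d / real \<theta>) * (z ^ \<theta> * z ^ d)
      = real n powr ((- 1 - real d / real \<theta>) + (real \<theta> / real \<theta> + real d / real \<theta>))"
    by (simp only: zpow powr_add)
  also have "\<dots> = 1" using assms(1,2) by simp
  finally have "real n powr (- 1 - real d / real \<theta>) * (z ^ \<theta> * z ^ d) = 1" .
  then show "real n powr (- 1 - real d / real \<theta>) = 1 / (z ^ \<theta> * z ^ d)"
    by (rule eq_divide_imp[rotated]) (use \<open>1 \<le> z\<close> in simp)
qed

lemma subcritical:
  fixes f p :: "nat \<Rightarrow> real"
  assumes \<theta>: "1 \<le> \<theta>"
    and p: "\<And>n. n \<ge> 1 \<Longrightarrow> 0 \<le> p n \<and> p n \<le> 1"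
    and pf: "\<And>n. n \<ge> 1 \<Longrightarrow> p n = f n * real n powr (- 1 - real d / real \<theta>)"
    and f: "f \<longlonglongrightarrow> 0"
  shows "(\<lambda>n. measure_pmf.prob (init_pmf n d (p n))
              {\<omega>. \<exists>v \<in> hamming_verts n d. \<theta> \<le> nbr_sum n d \<omega> v}) \<longlonglongrightarrow> 0"
proof (rule tendsto_sandwich[where f = "\<lambda>_. 0" and h = "\<lambda>n. (real d * f n) ^ \<theta>"])
  show "\<forall>\<^sub>F n in sequentially. measure_pmf.prob (init_pmf n d (p n))
      {\<omega>. \<exists>v \<in> hamming_verts n d. \<theta> \<le> nbr_sum n d \<omega> v} \<le> (real d * f n) ^ \<theta>"
    using eventually_ge_at_top[of 1]
  proof eventually_elim
    case (elim n)
    define z where "z = real n powr (1 / real \<theta>)"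
    have z: "1 \<le> z" "z ^ \<theta> = real n" "p n = f n / (z ^ \<theta> * z ^ d)"
      using critical_scale(1,2)[OF elim, of \<theta>] critical_scale(3)[OF elim, of \<theta> d] \<theta> pf[OF elim] by (simp_all add: z_def)
    have "real n * p n = f n / z ^ d" using z(1) by (simp add: z(3) flip: z(2))
    moreover have "real n ^ d = (z ^ d) ^ \<theta>" by (simp flip: z(2) power_mult add: mult.commute)
    ultimately have "real n ^ d * (real d * real n * p n) ^ \<theta> = (z ^ d) ^ \<theta> * (real d * (f n / z ^ d)) ^ \<theta>"
      by (simp add: mult.assoc)
    also have "\<dots> = (real d * f n) ^ \<theta>" using z(1) by (simp flip: power_mult_distrib)
    finally show ?case using prob_threshold_le[of "p n" n d \<theta>] p[OF elim] by simp
  qed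
  show "(\<lambda>n. (real d * f n) ^ \<theta>) \<longlonglongrightarrow> 0"
    using tendsto_power[OF tendsto_mult[OF tendsto_const f], of "real d" \<theta>] \<theta> by (simp add: power_0_left)
qed auto

lemma supercritical:
  fixes f p :: "nat \<Rightarrow> real"
  assumes d: "3 \<le> d" and \<theta>: "3 \<le> \<theta>"
    and p: "\<And>n. n \<ge> 1 \<Longrightarrow> 0 \<le> p n \<and> p n \<le> 1"
    and pf: "\<And>n. n \<ge> 1 \<Longrightarrow> p n = f n * real n powr (- 1 - real d / real \<theta>)"
    and f: "filterlim f at_top sequentially"
  shows "(\<lambda>n. measure_pmf.prob (init_pmf n d (p n))
              {\<omega>. \<exists>l. hamming_line n d l \<and> (\<forall>v \<in> l. bp_final n d \<theta> \<omega> v = 1)}) \<longlonglongrightarrow> 1"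
proof -
  define k where "k = ((d - 1) * \<theta>) div d"
  note k = exponent_choice[OF d \<theta>, folded k_def]
  \<comment> \<open>Blocks of size \<open>m = n div (3 \<theta>)\<close> fit \<open>2 \<theta> + 1\<close> times into \<open>n\<close> because \<open>2 \<theta> + 1 \<le> 3 \<theta>\<close>, and
    rounding down costs at most a factor 2, whence \<open>c n \<le> m\<close>.\<close>
  define c where "c = 1 / (6 * real \<theta>)"
  have c: "0 < c" "c \<le> 1" using \<theta> by (auto simp: c_def)
  define z where "z n = real n powr (1 / real \<theta>)" for n
  \<comment> \<open>The value for which \<open>g / z ^ d = min 1 (c f / z ^ d) / 2\<close>, a lower bound for the probability that a
    block is hit.\<close>
  define g where "g n = min (z n ^ d / 2) (c * f n / 2)" for n
  \<comment> \<open>One factor 1/2 for each of the first two conditions on a good plane and \<open>\<theta>\<close> such factors for the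
    columns of the third.\<close>
  define q where "q n = (1 / 2) ^ \<theta> / 4 * min (real n) (c\<^sup>2 * g n)" for n
  have z_lim: "filterlim z at_top sequentially"
    unfolding z_def using \<theta> by real_asymp
  have "filterlim (\<lambda>n. z n ^ d / 2) at_top sequentially"
    using filterlim_tendsto_pos_mult_at_top[OF tendsto_const _ filterlim_pow_at_top[OF _ z_lim], of "1 / 2" d] d
    by simp
  moreover have "filterlim (\<lambda>n. c * f n / 2) at_top sequentially"
    using filterlim_tendsto_pos_mult_at_top[OF tendsto_const _ f, of "c / 2"] c by simp
  ultimately have g_lim: "filterlim g at_top sequentially"
    unfolding g_def by (rule filterlim_min_at_top)
  have "filterlim (\<lambda>n. c\<^sup>2 * g n) at_top sequentially"
    by (rule filterlim_tendsto_pos_mult_at_top[OF tendsto_const _ g_lim]) (use c in simp)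
  with filterlim_real_sequentially have "filterlim (\<lambda>n. min (real n) (c\<^sup>2 * g n)) at_top sequentially"
    by (rule filterlim_min_at_top)
  then have q_lim: "filterlim q at_top sequentially"
    unfolding q_def by (intro filterlim_tendsto_pos_mult_at_top[OF tendsto_const]) simp_all
  have lower: "\<forall>\<^sub>F n in sequentially. 1 - exp (- q n) \<le> measure_pmf.prob (init_pmf n d (p n))
              {\<omega>. \<exists>l. hamming_line n d l \<and> (\<forall>v \<in> l. bp_final n d \<theta> \<omega> v = 1)}"
    using eventually_ge_at_top[of "3 * \<theta>"]
      filterlim_at_top[THEN iffD1, OF g_lim, rule_format, of 1]
      filterlim_at_top[THEN iffD1, OF z_lim, rule_format, of "1 / c"]
  proof eventually_elim
    case (elim n)
    have n: "1 \<le> n" using elim(1) \<theta> by simp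
    define m where "m = n div (3 * \<theta>)"
    define u where "u = min 1 (real m * p n) / 2"
    have z: "1 \<le> z n" "z n ^ \<theta> = real n" "p n = f n / (z n ^ \<theta> * z n ^ d)"
      using critical_scale(1,2)[OF n, of \<theta>] critical_scale(3)[OF n, of \<theta> d] \<theta> pf[OF n] by (simp_all add: z_def)
    have p_n: "0 \<le> p n" "p n \<le> 1" using p[OF n] by auto
    have "3 * \<theta> * m \<le> n" by (simp add: m_def)
    moreover have "(2 * \<theta> + 1) * m \<le> 3 * \<theta> * m" using \<theta> by (intro mult_le_mono1) simp
    ultimately have m: "(2 * \<theta> + 1) * m \<le> n" by (rule order_trans[rotated])
    have "1 \<le> m" unfolding m_def using elim(1) \<theta> div_le_mono[of "3 * \<theta>" n "3 * \<theta>"] by simp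
    have "n < 3 * \<theta> * m + 3 * \<theta>"
      using \<theta> mult_div_mod_eq[of "3 * \<theta>" n] mod_less_divisor[of "3 * \<theta>" n] unfolding m_def by linarith
    also have "\<dots> \<le> 6 * \<theta> * m" using \<open>1 \<le> m\<close> by (cases m) simp_all
    finally have "real n \<le> 6 * real \<theta> * real m" by (metis less_imp_le of_nat_le_iff of_nat_mult of_nat_numeral)
    then have cm: "c * real n \<le> real m" using \<theta> by (simp add: c_def field_simps)
    have "c * f n / z n ^ d = c * real n * p n" using z(1) by (simp add: z(3) flip: z(2))
    also have "\<dots> \<le> real m * p n" using cm p_n(1) by (rule mult_right_mono)
    finally have "min 1 (c * f n / z n ^ d) / 2 \<le> u" by (simp add: u_def)
    moreover have "g n / z n ^ d = min 1 (c * f n / z n ^ d) / 2"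
      using z(1) by (simp add: g_def min_def field_simps)
    ultimately have u: "g n / z n ^ d \<le> u" by linarith
    have u0: "0 \<le> u" using p_n by (simp add: u_def)
    have "c * z n ^ \<theta> \<le> real m" using cm z(2) by simp
    note growth = plane_count_growth[OF z(1) elim(2) c this u d k]
    define x y w where "x = real m * u ^ k" and "y = real m * u ^ (\<theta> - k)"
      and "w = real m * u ^ (\<theta> - k - 1)"
    have pos: "0 \<le> x" "0 \<le> y" "0 \<le> w" using u0 by (simp_all add: x_def y_def w_def)
    have "1 \<le> c * z n" using elim(3) c by (simp add: field_simps)
    then have "min 1 w = 1" using growth(2) by (simp add: w_def)
    then have w: "1 / 2 \<le> 1 - exp (- w)" using one_minus_exp_ge[OF pos(3)] by simp
    have "q n \<le> (1 / 2) ^ \<theta> / 4 * (real n ^ (d - 2) * (min 1 x * min 1 y))"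
      unfolding q_def using growth(1) by (intro mult_left_mono) (simp_all add: z(2) x_def y_def)
    also have "\<dots> = real n ^ (d - 2) * (min 1 x / 2 * (min 1 y / 2 * (1 / 2) ^ \<theta>))" by simp
    also have "\<dots> \<le> real n ^ (d - 2) * ((1 - exp (- x)) * ((1 - exp (- y)) * (1 - exp (- w)) ^ \<theta>))"
      using one_minus_exp_ge pos w by (intro mult_left_mono mult_mono power_mono) auto
    finally have "1 - exp (- q n) \<le> 1 - exp (- (real n ^ (d - 2) *
        ((1 - exp (- x)) * ((1 - exp (- y)) * (1 - exp (- w)) ^ \<theta>))))" by simp
    also have "\<dots> \<le> measure_pmf.prob (init_pmf n d (p n))
        {\<omega>. \<exists>l. hamming_line n d l \<and> (\<forall>v \<in> l. bp_final n d \<theta> \<omega> v = 1)}"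
      unfolding x_def y_def w_def u_def using d by (intro prob_line_filled_ge[OF p_n _ k(2) m]) simp
    finally show ?case .
  qed
  have "(\<lambda>n. exp (- q n)) \<longlonglongrightarrow> 0"
    by (rule filterlim_compose[OF exp_at_bot]) (use q_lim in \<open>simp add: filterlim_uminus_at_top\<close>)
  then have "(\<lambda>n. 1 - exp (- q n)) \<longlonglongrightarrow> 1" using tendsto_diff[OF tendsto_const, of _ 0 sequentially "1::real"] by simp
  from tendsto_sandwich[OF lower _ this tendsto_const] show ?thesis by simp
qed

theorem theorem2p3:
  fixes d \<theta> :: nat and f p :: "nat \<Rightarrow> real"
  assumes "d \<ge> 3" and "\<theta> \<ge> 3"
    and "\<And>n. n \<ge> 1 \<Longrightarrow> 0 \<le> p n \<and> p n \<le> 1"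
    and "\<And>n. n \<ge> 1 \<Longrightarrow> p n = f n * real n powr (- 1 - real d / real \<theta>)"
  shows "(f \<longlonglongrightarrow> 0 \<longrightarrow>
           (\<lambda>n. measure_pmf.prob (init_pmf n d (p n))
              {\<omega>. \<exists>v \<in> hamming_verts n d. \<theta> \<le> nbr_sum n d \<omega> v}) \<longlonglongrightarrow> 0) \<and>
         (filterlim f at_top sequentially \<longrightarrow>
           (\<lambda>n. measure_pmf.prob (init_pmf n d (p n))
              {\<omega>. \<exists>l. hamming_line n d l \<and> (\<forall>v \<in> l. bp_final n d \<theta> \<omega> v = 1)}) \<longlonglongrightarrow> 1)"
  using subcritical[of \<theta> p f d] supercritical[of d \<theta> p f] assms by simp

end
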